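(* Let $G$ be a connected $k$-regular graph with $n$ vertices and $m$ unoriented edges, with $k>2$ and girth $g(G)>4$. Let $\mathbf{A}$ be its adjacency matrix and $\mathbf{U}$ its Grover transition matrix. Then the characteristic polynomial of $(\mathbf{U}^3)^+$ is $$\det(\lambda\mathbf{I}_{2m}-(\mathbf{U}^3)^+)=(\lambda^2-4)^{m-n}\det\Big(\lambda^2\mathbf{I}_n-\lambda\big(\mathbf{A}^3-(3k-4)\mathbf{A}\big)+\big(\mathbf{A}^4-k^2\mathbf{A}^2+2(k-1)(k^2-2k+2)\mathbf{I}_n\big)\Big).$$
   Context: Graphs are finite and may have multiple edges and loops. $D(G)=\{(u,v),(v,u)\mid uv\in E(G)\}$ is the set of arcs, two mutually inverse arcs for each edge; for an arc $e=(u,v)$ put $o(e)=u$, $t(e)=v$, $e^{-1}=(v,u)$. The degree $d_v=\deg v$ is the number of edges incident to $v$; $G$ is $k$-regular if $\deg v=k$ for every vertex $v$. A cycle is a sequence $C=(v_0,e_1,v_1,\dots,v_{s-1},e_s,v_s)$ with $e_i\in D(G)$, $o(e_i)=v_{i-1}$, $t(e_i)=v_i$ and $v_0=v_s$; it is reduced if $e_{i+1}^{-1}\neq e_i$ for $1\le i\le s-1$. A (reduced) cycle is essential if all its vertices except $v_0,v_s$ are distinct and $s\ge2$. The girth $g(G)$ is the minimum length $s$ of essential cycles in $G$. The Grover transition matrix $\mathbf{U}=(U_{ef})_{e,f\in D(G)}$ is defined by $U_{ef}=2/d_{t(f)}$ if $t(f)=o(e)$ and $f\ne e^{-1}$; $U_{ef}=2/d_{t(f)}-1$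 if $f=e^{-1}$; and $U_{ef}=0$ otherwise. The positive support $\mathbf{F}^+$ of a real square matrix $\mathbf{F}$ has $F^+_{ij}=1$ if $F_{ij}>0$ and $0$ otherwise. *)

theory Defs
  imports
    "Graph_Theory.Graph_Theory"
    "Jordan_Normal_Form.Char_Poly"
    "HOL-Library.Extended_Nat"
begin

text \<open>
  A finite graph with multiple edges and loops is represented by its arcs: a finite
  \<^locale>\<open>bidirected_digraph\<close>, whose involution \<open>arev\<close> has no fixed point on the arcs and
  exchanges tail and head. The arcs form \<open>D(G)\<close>, with \<open>o(e) = tail G e\<close>, \<open>t(e) = head G e\<close> and
  inverse \<open>arev e\<close>. An unoriented edge is a pair \<open>{e, arev e}\<close>; a loop, too, has two
  distinct arcs.
\<close>

definition edges :: "('v, 'e) pre_digraph \<Rightarrow> ('e \<Rightarrow> 'e) \<Rightarrow> 'e set set" where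
  "edges G arev = (\<lambda>e. {e, arev e}) ` arcs G"

text \<open>
  An edge contains both of its arcs, so it is incident to \<open>v\<close> iff one of them starts at \<open>v\<close>.
  A loop counts once, both here and in the adjacency matrix.
\<close>

definition vertex_degree :: "('v, 'e) pre_digraph \<Rightarrow> ('e \<Rightarrow> 'e) \<Rightarrow> 'v \<Rightarrow> nat" where
  "vertex_degree G arev v = card {E \<in> edges G arev. \<exists>e\<in>E. tail G e = v}"

definition regular :: "('v, 'e) pre_digraph \<Rightarrow> ('e \<Rightarrow> 'e) \<Rightarrow> nat \<Rightarrow> bool" where
  "regular G arev k \<longleftrightarrow> (\<forall>v\<in>verts G. vertex_degree G arev v = k)"

definition reduced :: "('e \<Rightarrow> 'e) \<Rightarrow> 'e list \<Rightarrow> bool" where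
  "reduced arev p \<longleftrightarrow> (\<forall>i. Suc i < length p \<longrightarrow> arev (p ! Suc i) \<noteq> p ! i)"

text \<open>
  If \<open>p\<close> is the arc sequence of \<open>(v\<^sub>0, e\<^sub>1, \<dots>, e\<^sub>s, v\<^sub>s)\<close>, then \<^const>\<open>pre_digraph.awalk_verts\<close>
  is \<open>[v\<^sub>0, \<dots>, v\<^sub>s]\<close>, and \<open>tl (butlast _)\<close> leaves the vertices \<open>v\<^sub>1, \<dots>, v\<^sub>s\<^sub>-\<^sub>1\<close> that have to be
  distinct. A loop \<open>e\<close> gives the essential cycle \<open>[e, e]\<close> of length 2.
\<close>

definition essential_cycle :: "('v, 'e) pre_digraph \<Rightarrow> ('e \<Rightarrow> 'e) \<Rightarrow> 'e list \<Rightarrow> bool" where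
  "essential_cycle G arev p \<longleftrightarrow>
     (\<exists>u. pre_digraph.awalk G u p u \<and> reduced arev p \<and> 2 \<le> length p \<and>
          distinct (tl (butlast (pre_digraph.awalk_verts G u p))))"

text \<open>The girth is \<open>\<infinity>\<close> if there is no essential cycle.\<close>

definition girth :: "('v, 'e) pre_digraph \<Rightarrow> ('e \<Rightarrow> 'e) \<Rightarrow> enat" where
  "girth G arev = (INF p \<in> {p. essential_cycle G arev p}. enat (length p))"

text \<open>
  Matrices indexed by vertices or arcs are taken with respect to an enumeration of the
  index set by a list.
\<close>

definition adjacency_matrix ::
  "('v, 'e) pre_digraph \<Rightarrow> ('e \<Rightarrow> 'e) \<Rightarrow> 'v list \<Rightarrow> real mat" where
  "adjacency_matrix G arev vs = mat (length vs) (length vs) (\<lambda>(i, j).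
     real (card {E \<in> edges G arev. \<exists>e\<in>E. tail G e = vs ! i \<and> head G e = vs ! j}))"

definition grover_entry ::
  "('v, 'e) pre_digraph \<Rightarrow> ('e \<Rightarrow> 'e) \<Rightarrow> 'e \<Rightarrow> 'e \<Rightarrow> real" where
  "grover_entry G arev e f =
     (if f = arev e then 2 / real (vertex_degree G arev (head G f)) - 1
      else if head G f = tail G e then 2 / real (vertex_degree G arev (head G f))
      else 0)"

definition grover_matrix ::
  "('v, 'e) pre_digraph \<Rightarrow> ('e \<Rightarrow> 'e) \<Rightarrow> 'e list \<Rightarrow> real mat" where
  "grover_matrix G arev es =
     mat (length es) (length es) (\<lambda>(i, j). grover_entry G arev (es ! i) (es ! j))"

definition positive_support :: "real mat \<Rightarrow> real mat" where
  "positive_support F = map_mat (\<lambda>x. if x > 0 then 1 else 0) F"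

definition const_poly_mat :: "real mat \<Rightarrow> real poly mat" where
  "const_poly_mat M = map_mat (\<lambda>a. [:a:]) M"

end

theory Submission
  imports Defs
begin

text \<open>
  Write \<open>c = 2 / k\<close>, \<open>[P]\<close> for the indicator of \<open>P\<close>, \<open>A\<close> for the adjacency matrix, and \<open>T\<close>, \<open>H\<close> for the
  vertex-arc incidence matrices of tails and heads. Expanding \<open>U = c T\<^sup>t H - J\<close>, with \<open>J\<close> the arc
  reversal, gives for arcs \<open>e\<close>, \<open>f\<close>
  \<open>(U\<^sup>3)(e, f) = c\<^sup>3 A\<^sup>2(o e, t f) - c\<^sup>2 (A(o e, o f) + A(t e, t f)) + c [t e = o f] - [f = e\<^sup>-\<^sup>1]\<close>.
  Girth above 4 makes \<open>A\<^sup>2\<close> a 0/1 matrix off the diagonal, and checking signs shows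
  \<open>(U\<^sup>3)\<^sup>+ = T\<^sup>t (A\<^sup>2 H - A T - (k - 2) H) + H\<^sup>t (2 T - A H) - 2 J = Q R - 2 J\<close> with \<open>Q = [T\<^sup>t | H\<^sup>t]\<close>.
  As \<open>J\<close> swaps the two halves of \<open>Q\<close>, \<open>(\<lambda> + 2 J) Q = Q S\<close> for a block matrix \<open>S\<close>, and a Sylvester-type
  identity turns the determinant of size \<open>2m\<close> into \<open>det (S - R Q)\<close>, of size \<open>2n\<close>, whose blocks are
  polynomials in \<open>A\<close>.
\<close>

section \<open>Determinant identities over integral domains and polynomial rings\<close>

text \<open>
  Both sides are \<open>det K * det S\<close> for the bordered matrix \<open>K\<close> with rows \<open>[Z, Q]\<close> and \<open>[R, 1]\<close>, computed by two
  different column eliminations; no invertibility of \<open>Z\<close> or \<open>S\<close> is needed.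
\<close>

lemma det_diff_mult:
  fixes Z :: "'a :: idom mat"
  assumes Z: "Z \<in> carrier_mat N N" and Q: "Q \<in> carrier_mat N r"
    and R: "R \<in> carrier_mat r N" and S: "S \<in> carrier_mat r r"
    and comm: "Z * Q = Q * S"
  shows "det (Z - Q * R) * det S = det Z * det (S - R * Q)"
proof -
  let ?K = "four_block_mat Z Q R (1\<^sub>m r)"
  let ?L = "four_block_mat (1\<^sub>m N) (0\<^sub>m N r) (- R) (1\<^sub>m r)"
  let ?M = "four_block_mat (1\<^sub>m N) (- Q) (0\<^sub>m r N) S"
  have K: "?K \<in> carrier_mat (N + r) (N + r)"
    and L: "?L \<in> carrier_mat (N + r) (N + r)"
    and M: "?M \<in> carrier_mat (N + r) (N + r)"
    using assms by auto
  have "?K * ?L = four_block_mat (Z - Q * R) Q (0\<^sub>m r N) (1\<^sub>m r)"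
    using Z Q R
    by (subst mult_four_block_mat[OF Z Q R one_carrier_mat])
      (auto intro!: cong_four_block_mat eq_matI)
  then have "det (?K * ?L) = det (Z - Q * R)"
    using Q by (simp add: det_four_block_mat_lower_left_zero[where n = N and m = r] Z R minus_carrier_mat[OF mult_carrier_mat[OF Q R]])
  moreover have "det ?L = 1"
    using R by (subst det_four_block_mat_upper_right_zero[where n = N and m = r]) auto
  ultimately have det1: "det ?K = det (Z - Q * R)"
    using det_mult[OF K L] by simp
  \<comment> \<open>This is where Z Q = Q S enters: it clears the upper right block of the second
    product.\<close>
  have "Z * (- Q) + Q * S = 0\<^sub>m N r"
    using Z Q S comm by (auto intro!: eq_matI)
  moreover have "R * (- Q) + 1\<^sub>m r * S = S - R * Q"
    using R Q S by (auto intro!: eq_matI)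
  ultimately have "?K * ?M = four_block_mat Z (0\<^sub>m N r) R (S - R * Q)"
    using Z Q R S
    by (subst mult_four_block_mat[OF Z Q R one_carrier_mat])
      (auto intro!: cong_four_block_mat eq_matI)
  then have "det (?K * ?M) = det Z * det (S - R * Q)"
    using R by (simp add: det_four_block_mat_upper_right_zero[where n = N and m = r] Z Q minus_carrier_mat[OF mult_carrier_mat[OF R Q]])
  moreover have "det ?M = det S"
    using Q S by (subst det_four_block_mat_lower_left_zero[where n = N and m = r]) auto
  ultimately show ?thesis
    using det_mult[OF K M] det1 by simp
qed

text \<open>
  Conjugation with an orientation, a sign vector \<open>s\<close> with \<open>s (p i) = - s i\<close>, maps \<open>X + 2 P\<close> to
  \<open>X - 2 P\<close>, and their product is \<open>X\<^sup>2 - 4\<close>. This gives the square of the determinant; the sign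
  follows since it is monic.
\<close>

lemma det_fixfree_involution:
  fixes p :: "nat \<Rightarrow> nat"
  assumes p: "\<And>i. i < 2 * m \<Longrightarrow> p i < 2 * m \<and> p (p i) = i \<and> p i \<noteq> i"
  defines "Z \<equiv> mat (2 * m) (2 * m)
    (\<lambda>(i, j). if i = j then [:0, 1:] else if j = p i then 2 else 0 :: real poly)"
  shows "det Z = ([:0, 1:]\<^sup>2 - 4) ^ m"
proof -
  let ?N = "2 * m"
  let ?X = "[:0, 1:] :: real poly"
  define Z' where "Z' = mat ?N ?N (\<lambda>(i, j). if i = j then ?X else if j = p i then - 2 else 0)"
  define s :: "nat \<Rightarrow> real poly" where "s i = (if i < p i then 1 else - 1)" for i
  have Z: "Z \<in> carrier_mat ?N ?N" and Z': "Z' \<in> carrier_mat ?N ?N"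
    by (auto simp: Z_def Z'_def)
  have D: "mat_diag ?N s \<in> carrier_mat ?N ?N" by simp
  have s2: "s i * s i = 1" for i by (simp add: s_def)
  have sp: "s i * s (p i) = - 1" if "i < ?N" for i
    using p[OF that] by (auto simp: s_def)
  have "mat_diag ?N s * Z * mat_diag ?N s = Z'"
    unfolding mat_diag_mult_left[OF Z] using sp s2
    by (subst mat_diag_mult_right[where nr = ?N]) (auto simp: Z_def Z'_def ac_simps intro!: eq_matI)
  moreover have "mat_diag ?N s * mat_diag ?N s = 1\<^sub>m ?N"
    unfolding mat_diag_diag s2 by (auto simp: mat_diag_def)
  then have "det (mat_diag ?N s) * det (mat_diag ?N s) = 1"
    using det_mult[OF D D] by simp
  ultimately have det': "det Z' = det Z"
    using det_mult[OF D Z] det_mult[OF mult_carrier_mat[OF D Z] D] by (simp add: algebra_simps)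
  have "Z * Z' = (?X\<^sup>2 - 4) \<cdot>\<^sub>m 1\<^sub>m ?N"
  proof (rule eq_matI)
    fix i j assume "i < dim_row ((?X\<^sup>2 - 4) \<cdot>\<^sub>m 1\<^sub>m ?N)" "j < dim_col ((?X\<^sup>2 - 4) \<cdot>\<^sub>m 1\<^sub>m ?N)"
    then have ij: "i < ?N" "j < ?N" by auto
    have "(Z * Z') $$ (i, j) = (\<Sum>l<?N. Z $$ (i, l) * Z' $$ (l, j))"
      using ij Z Z' by (simp add: scalar_prod_def lessThan_atLeast0)
    \<comment> \<open>Row i of \<open>Z\<close> vanishes outside the columns i and p i.\<close>
    also have "\<dots> = (\<Sum>l\<in>{i, p i}. Z $$ (i, l) * Z' $$ (l, j))"
      using ij p by (intro sum.mono_neutral_right) (auto simp: Z_def)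
    also have "\<dots> = ((?X\<^sup>2 - 4) \<cdot>\<^sub>m 1\<^sub>m ?N) $$ (i, j)"
      using ij p[OF ij(1)] by (auto simp: Z_def Z'_def power2_eq_square)
    finally show "(Z * Z') $$ (i, j) = ((?X\<^sup>2 - 4) \<cdot>\<^sub>m 1\<^sub>m ?N) $$ (i, j)" .
  qed (use Z Z' in auto)
  then have "det (Z * Z') = (?X\<^sup>2 - 4) ^ (2 * m)"
    by simp
  then have "(det Z)\<^sup>2 = ((?X\<^sup>2 - 4) ^ m)\<^sup>2"
    using det_mult[OF Z Z'] det' by (simp only: power2_eq_square[of "det Z"] power_even_eq)
  then have "det Z = (?X\<^sup>2 - 4) ^ m \<or> det Z = - ((?X\<^sup>2 - 4) ^ m)"
    by (simp add: power2_eq_iff)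
  moreover have "lead_coeff (det Z) = 1"
  proof -
    \<comment> \<open>With this sign \<open>Z\<close> is \<lambda> - \<open>W\<close>, so its
      determinant is a characteristic polynomial and therefore monic.\<close>
    define W :: "real mat" where "W = mat ?N ?N (\<lambda>(i, j). if j = p i then - 2 else 0)"
    have "Z = char_poly_matrix W"
      by (rule eq_matI) (use p in \<open>force simp: Z_def W_def char_poly_matrix_def numeral_poly\<close>)+
    then show ?thesis
      using degree_monic_char_poly[of W ?N] by (simp add: char_poly_def W_def)
  qed
  moreover have "lead_coeff ((?X\<^sup>2 - 4) ^ m) = 1"
    by (simp add: lead_coeff_power power2_eq_square numeral_poly)
  ultimately show ?thesis
    by (auto simp del: power_Suc)
qed

text \<open>All four blocks are polynomials in \<open>B\<close>. Hence the two lower ones commute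
  and the determinant is that of a single n by n polynomial in \<open>B\<close>, which is then
  expanded. In the application x is \<lambda>, \<open>B\<close> is the adjacency matrix and q = k -
  1; thus 3 q - 1 = 3 k - 4 and q^2 + 1 = k^2 - 2 k + 2.\<close>

lemma det_adjacency_blocks:
  fixes B :: "'a :: idom mat"
  assumes B[simp]: "B \<in> carrier_mat n n"
  shows "det (four_block_mat
      (x \<cdot>\<^sub>m 1\<^sub>m n - (B ^\<^sub>m 3 - (2 * q) \<cdot>\<^sub>m B)) ((q\<^sup>2 + 1) \<cdot>\<^sub>m 1\<^sub>m n - q \<cdot>\<^sub>m B ^\<^sub>m 2)
      (B ^\<^sub>m 2 - (2 * q) \<cdot>\<^sub>m 1\<^sub>m n) (x \<cdot>\<^sub>m 1\<^sub>m n + (q - 1) \<cdot>\<^sub>m B)) =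
    det (x\<^sup>2 \<cdot>\<^sub>m 1\<^sub>m n - x \<cdot>\<^sub>m (B ^\<^sub>m 3 - (3 * q - 1) \<cdot>\<^sub>m B)
      + (B ^\<^sub>m 4 - (q + 1)\<^sup>2 \<cdot>\<^sub>m B ^\<^sub>m 2 + (2 * q * (q\<^sup>2 + 1)) \<cdot>\<^sub>m 1\<^sub>m n))"
proof -
  have [simp]: "B ^\<^sub>m i \<in> carrier_mat n n" for i
    using B by (rule pow_carrier_mat)
  have dims[simp]: "dim_row B = n" "dim_col B = n"
    using carrier_matD[OF B] by auto
  have [simp]: "P * R \<in> carrier_mat n n"
    if "P \<in> carrier_mat n n" "R \<in> carrier_mat n n" for P R :: "'a mat"
    using that by (rule mult_carrier_mat)
  have pow: "B ^\<^sub>m 2 = B * B" "B ^\<^sub>m 3 = B * (B * B)" "B ^\<^sub>m 4 = B * (B * (B * B))"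
    by (simp_all add: numeral_eq_Suc assoc_mult_mat[where n\<^sub>1 = n and n\<^sub>2 = n and n\<^sub>3 = n and n\<^sub>4 = n])
  note distr = add_mult_distrib_mat[where nr = n and n = n and nc = n] mult_add_distrib_mat[where nr = n and n = n and nc = n]
    minus_mult_distrib_mat[where nr = n and n = n and nc = n] mult_minus_distrib_mat[where nr = n and n = n and nc = n]
    mult_smult_distrib[where nr = n and n = n and nc = n] mult_smult_assoc_mat[where nr = n and n = n and nc = n]
    assoc_mult_mat[where n\<^sub>1 = n and n\<^sub>2 = n and n\<^sub>3 = n and n\<^sub>4 = n]
  have "(B ^\<^sub>m 2 - (2 * q) \<cdot>\<^sub>m 1\<^sub>m n) * (x \<cdot>\<^sub>m 1\<^sub>m n + (q - 1) \<cdot>\<^sub>m B)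
      = (x \<cdot>\<^sub>m 1\<^sub>m n + (q - 1) \<cdot>\<^sub>m B) * (B ^\<^sub>m 2 - (2 * q) \<cdot>\<^sub>m 1\<^sub>m n)"
    \<comment> \<open>Powers are right-nested products here. Removing
      \<open>index_mult_mat(1)\<close> keeps their entries atomic, so that only linear combinations
      of such entries are compared.\<close>
    unfolding pow by (simp add: distr minus_carrier_mat) (auto simp: algebra_simps simp del: index_mult_mat(1) intro!: eq_matI)
  then have "det (four_block_mat
      (x \<cdot>\<^sub>m 1\<^sub>m n - (B ^\<^sub>m 3 - (2 * q) \<cdot>\<^sub>m B)) ((q\<^sup>2 + 1) \<cdot>\<^sub>m 1\<^sub>m n - q \<cdot>\<^sub>m B ^\<^sub>m 2)
      (B ^\<^sub>m 2 - (2 * q) \<cdot>\<^sub>m 1\<^sub>m n) (x \<cdot>\<^sub>m 1\<^sub>m n + (q - 1) \<cdot>\<^sub>m B)) =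
    det ((x \<cdot>\<^sub>m 1\<^sub>m n - (B ^\<^sub>m 3 - (2 * q) \<cdot>\<^sub>m B)) * (x \<cdot>\<^sub>m 1\<^sub>m n + (q - 1) \<cdot>\<^sub>m B)
      - ((q\<^sup>2 + 1) \<cdot>\<^sub>m 1\<^sub>m n - q \<cdot>\<^sub>m B ^\<^sub>m 2) * (B ^\<^sub>m 2 - (2 * q) \<cdot>\<^sub>m 1\<^sub>m n))"
    by (intro det_four_block_mat[of _ n]) auto
  also have "(x \<cdot>\<^sub>m 1\<^sub>m n - (B ^\<^sub>m 3 - (2 * q) \<cdot>\<^sub>m B)) * (x \<cdot>\<^sub>m 1\<^sub>m n + (q - 1) \<cdot>\<^sub>m B)
      - ((q\<^sup>2 + 1) \<cdot>\<^sub>m 1\<^sub>m n - q \<cdot>\<^sub>m B ^\<^sub>m 2) * (B ^\<^sub>m 2 - (2 * q) \<cdot>\<^sub>m 1\<^sub>m n) =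
    x\<^sup>2 \<cdot>\<^sub>m 1\<^sub>m n - x \<cdot>\<^sub>m (B ^\<^sub>m 3 - (3 * q - 1) \<cdot>\<^sub>m B)
      + (B ^\<^sub>m 4 - (q + 1)\<^sup>2 \<cdot>\<^sub>m B ^\<^sub>m 2 + (2 * q * (q\<^sup>2 + 1)) \<cdot>\<^sub>m 1\<^sub>m n)"
    unfolding pow by (simp add: distr minus_carrier_mat)
      (auto simp: algebra_simps power2_eq_square simp del: index_mult_mat(1) intro!: eq_matI)
  finally show ?thesis .
qed

section \<open>Local structure of a regular graph of girth above 4\<close>

locale sparse_regular_graph = fin_digraph G + bidirected_digraph G arev
  for G :: "('v, 'e) pre_digraph" and arev +
  fixes k :: nat
  assumes regular: "regular G arev k"
    and girth_gt_4: "girth G arev > 4"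
begin

lemma essential_cycle_length:
  assumes "essential_cycle G arev p"
  shows "length p > 4"
proof -
  have "girth G arev \<le> enat (length p)"
    unfolding girth_def using assms by (intro INF_lower) simp
  then show ?thesis
    using girth_gt_4 by (metis enat_ord_simps(2) numeral_eq_enat order_less_le_trans)
qed

text \<open>Traversing a loop twice in the same direction is an essential cycle of length 2; it is
  reduced because \<open>arev\<close> has no fixed point.\<close>

lemma no_loop:
  assumes "e \<in> arcs G"
  shows "tail G e \<noteq> head G e"
proof
  assume "tail G e = head G e"
  then have "essential_cycle G arev [e, e]"
    using assms arev_neq
    by (auto simp: essential_cycle_def reduced_def awalk_def less_Suc_eq intro!: exI[of _ "tail G e"])
  then show False using essential_cycle_length by fastforce
qed

text \<open>Going along e and back along f would be a reduced closed walk of length 2.\<close>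

lemma no_parallel:
  assumes "e \<in> arcs G" "f \<in> arcs G" "tail G e = tail G f" "head G e = head G f"
  shows "e = f"
proof (rule ccontr)
  assume "e \<noteq> f"
  then have "essential_cycle G arev [e, arev f]"
    using assms
    by (auto simp: essential_cycle_def reduced_def awalk_def intro!: exI[of _ "tail G e"])
  then show False using essential_cycle_length by fastforce
qed

definition adj :: "'v \<Rightarrow> 'v \<Rightarrow> bool" where
  "adj u v \<longleftrightarrow> (\<exists>e\<in>arcs G. tail G e = u \<and> head G e = v)"

definition common_nbrs :: "'v \<Rightarrow> 'v \<Rightarrow> 'v set" where
  "common_nbrs u v = {w \<in> verts G. adj u w \<and> adj w v}"

lemma adj_arc: "e \<in> arcs G \<Longrightarrow> adj (tail G e) (head G e)"
  by (auto simp: adj_def)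

lemma adj_sym: "adj u v \<longleftrightarrow> adj v u"
  by (metis adj_def arev_in_arcs head_arev tail_arev)

lemma adj_verts: "adj u v \<Longrightarrow> u \<in> verts G \<and> v \<in> verts G"
  by (auto simp: adj_def)

lemma adj_irrefl: "\<not> adj u u"
  using no_loop by (force simp: adj_def)

text \<open>Two different common neighbours of u and v would close up to the essential 4-cycle u, w,
  v, w'. This makes A^2 a 0/1 matrix off the diagonal.\<close>

lemma common_nbr_unique:
  assumes "adj u w" "adj w v" "adj u w'" "adj w' v" "u \<noteq> v"
  shows "w = w'"
proof (rule ccontr)
  assume "w \<noteq> w'"
  obtain a b c d where "a \<in> arcs G" "tail G a = u" "head G a = w"
    and "b \<in> arcs G" "tail G b = w" "head G b = v"
    and "c \<in> arcs G" "tail G c = v" "head G c = w'"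
    and "d \<in> arcs G" "tail G d = w'" "head G d = u"
    using assms adj_sym unfolding adj_def by metis
  moreover have "w \<noteq> v" "w' \<noteq> v" "w \<noteq> u" "w' \<noteq> u"
    using assms adj_irrefl by auto
  ultimately have "essential_cycle G arev [a, b, c, d]"
    using \<open>w \<noteq> w'\<close> \<open>u \<noteq> v\<close>
    by (auto simp: essential_cycle_def reduced_def awalk_def less_Suc_eq nth_Cons split: nat.splits
        intro!: exI[of _ u])
  then show False using essential_cycle_length by fastforce
qed

lemma card_common_nbrs:
  assumes "u \<noteq> v" and w: "w \<in> common_nbrs u v"
  shows "card (common_nbrs u v) = 1"
proof -
  have "common_nbrs u v = {w}"
    using assms common_nbr_unique by (auto simp: common_nbrs_def)
  then show ?thesis by simp
qed

section \<open>Degrees, edge counts and sums over arcs\<close>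

text \<open>Without loops an edge at v has only one arc leaving v. Hence
  \<open>card_out_arcs\<close> may count arcs where the degree counts edges.\<close>

lemma inj_on_edge: "inj_on (\<lambda>e. {e, arev e}) {e \<in> arcs G. tail G e = v}"
  using no_loop by (fastforce simp: inj_on_def doubleton_eq_iff)

lemma card_out_arcs:
  assumes "v \<in> verts G"
  shows "card {e \<in> arcs G. tail G e = v} = k"
proof -
  have "{E \<in> edges G arev. \<exists>e\<in>E. tail G e = v} = (\<lambda>e. {e, arev e}) ` {e \<in> arcs G. tail G e = v}"
    by (auto simp: edges_def image_iff doubleton_eq_iff) (metis arev_arev arev_in_arcs insert_commute tail_arev)
  then have "vertex_degree G arev v = card {e \<in> arcs G. tail G e = v}"
    unfolding vertex_degree_def using card_image[OF inj_on_edge] by simp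
  then show ?thesis
    using regular assms by (simp add: regular_def)
qed

text \<open>By \<open>no_parallel\<close> at most one edge joins u and v, so the adjacency matrix
  has entries 0 and 1 only.\<close>

lemma card_edges_between:
  "card {E \<in> edges G arev. \<exists>e\<in>E. tail G e = u \<and> head G e = v} = of_bool (adj u v)"
proof (cases "adj u v")
  case True
  then obtain e where e: "e \<in> arcs G" "tail G e = u" "head G e = v"
    by (auto simp: adj_def)
  have "E = {e, arev e}" if "E \<in> edges G arev" and "\<exists>f\<in>E. tail G f = u \<and> head G f = v" for E
  proof -
    obtain g where g: "g \<in> arcs G" "E = {g, arev g}"
      using \<open>E \<in> edges G arev\<close> by (auto simp: edges_def)
    with that(2) e have "g = e \<or> arev g = e"
      using no_parallel by (metis arev_in_arcs empty_iff insert_iff)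
    then show ?thesis using g by auto
  qed
  then have "{E \<in> edges G arev. \<exists>e\<in>E. tail G e = u \<and> head G e = v} = {{e, arev e}}"
    using e by (auto simp: edges_def)
  then show ?thesis using True by simp
next
  case False
  then have "{E \<in> edges G arev. \<exists>e\<in>E. tail G e = u \<and> head G e = v} = {}"
    by (auto simp: edges_def adj_def)
  then show ?thesis using False by (simp only: card.empty of_bool_eq)
qed

text \<open>The edges partition the arcs into pairs, as \<open>arev\<close> is an involution without
  fixed points.\<close>

lemma card_arcs: "card (arcs G) = 2 * card (edges G arev)"
proof -
  have fin: "finite (edges G arev)"
    by (simp add: edges_def)
  have un: "\<Union> (edges G arev) = arcs G"
    by (auto simp: edges_def)
  have "2 * card (edges G arev) = card (\<Union> (edges G arev))"
  proof (rule card_partition)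
    fix E assume "E \<in> edges G arev"
    then show "card E = 2"
      using arev_neq by (force simp: edges_def card_2_iff)
  next
    fix E F assume "E \<in> edges G arev" "F \<in> edges G arev" "E \<noteq> F"
    then show "E \<inter> F = {}"
      by (auto simp: edges_def inj_eq[OF bij_is_inj[OF bij_arev]])
  qed (auto simp: un fin)
  then show ?thesis using un by simp
qed

text \<open>Arcs are grouped by their tails. Together with \<open>card_arcs\<close> this is the
  handshake identity 2 m = k n.\<close>

lemma card_arcs_regular: "card (arcs G) = k * card (verts G)"
proof -
  have "(\<Sum>e\<in>arcs G. 1::nat) = (\<Sum>v\<in>verts G. \<Sum>e | e \<in> arcs G \<and> tail G e = v. 1)"
    by (rule sum.group[symmetric]) auto
  then show ?thesis using card_out_arcs by simp
qed

text \<open>Since no two arcs are parallel, \<open>head G\<close> is injective on the arcs leaving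
  u. Sums over arcs thus become products with a row of A.\<close>

lemma sum_out_arcs:
  fixes \<phi> :: "'v \<Rightarrow> 'r :: comm_semiring_1"
  shows "(\<Sum>e | e \<in> arcs G \<and> tail G e = u. \<phi> (head G e)) = (\<Sum>w\<in>verts G. of_bool (adj u w) * \<phi> w)"
proof -
  have "(\<Sum>e | e \<in> arcs G \<and> tail G e = u. \<phi> (head G e)) = (\<Sum>w | w \<in> verts G \<and> adj u w. \<phi> w)"
    by (rule sum.reindex_cong[symmetric, where l = "head G"])
      (auto simp: inj_on_def adj_def intro: no_parallel)
  also have "\<dots> = (\<Sum>w\<in>verts G. of_bool (adj u w) * \<phi> w)"
    by (rule sum.mono_neutral_cong_left) auto
  finally show ?thesis .
qed

lemma sum_in_arcs_arev:
  "(\<Sum>e | e \<in> arcs G \<and> head G e = u. \<phi> e) = (\<Sum>e | e \<in> arcs G \<and> tail G e = u. \<phi> (arev e))"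
  by (rule sum.reindex_bij_witness[of _ arev arev]) auto

lemma sum_in_arcs:
  fixes \<phi> :: "'v \<Rightarrow> 'r :: comm_semiring_1"
  shows "(\<Sum>e | e \<in> arcs G \<and> head G e = u. \<phi> (tail G e)) = (\<Sum>w\<in>verts G. of_bool (adj u w) * \<phi> w)"
  unfolding sum_in_arcs_arev sum_out_arcs[symmetric] by (rule sum.cong) auto

lemma card_in_arcs:
  assumes "v \<in> verts G"
  shows "card {e \<in> arcs G. head G e = v} = k"
  using sum_in_arcs_arev[where u = v and \<phi> = "\<lambda>_. 1::nat"] card_out_arcs[OF assms] by simp

lemma sum_adj_eq:
  "(\<Sum>w\<in>verts G. of_bool (adj u w) * of_bool (v = w)) = (of_bool (adj u v) :: 'r :: comm_semiring_1)"
proof -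
  have "(\<Sum>w\<in>verts G. of_bool (adj u w) * of_bool (v = w)) = 
     (\<Sum>w\<in>verts G. if w = v then of_bool (adj u v) else (0 :: 'r))"
    by (rule sum.cong) auto
  then show ?thesis using adj_verts by auto
qed

text \<open>The left side is the (u, v) entry of A^2.\<close>

lemma sum_adj_adj:
  "(\<Sum>w\<in>verts G. of_bool (adj u w) * of_bool (adj w v)) =
    (of_nat (card (common_nbrs u v)) :: 'r :: comm_semiring_1)"
proof -
  have "(\<Sum>w\<in>verts G. of_bool (adj u w) * of_bool (adj w v)) =
     (\<Sum>w\<in>verts G. of_bool (adj u w \<and> adj w v) :: 'r)"
    by (rule sum.cong) auto
  then show ?thesis
    by (simp add: common_nbrs_def sum_of_bool_eq Int_def)
qed

lemma card_common_nbrs_self: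
  assumes "u \<in> verts G"
  shows "card (common_nbrs u u) = k"
proof -
  have "k = (\<Sum>e | e \<in> arcs G \<and> tail G e = u. 1)"
    using card_out_arcs[OF assms] by simp
  also have "\<dots> = (\<Sum>w\<in>verts G. of_bool (adj u w) * 1)"
    by (rule sum_out_arcs)
  also have "\<dots> = (\<Sum>w\<in>verts G. of_bool (adj u w) * of_bool (adj w u))"
    using adj_sym by (intro sum.cong) auto
  finally show ?thesis unfolding sum_adj_adj by simp
qed

lemma card_common_nbrs_commute: "card (common_nbrs u v) = card (common_nbrs v u)"
proof -
  have "common_nbrs u v = common_nbrs v u"
    using adj_sym by (auto simp: common_nbrs_def)
  then show ?thesis by simp
qed

section \<open>Entries of U^3 and their signs\<close>

definition grover_cube :: "'e \<Rightarrow> 'e \<Rightarrow> real" where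
  "grover_cube e f =
    (\<Sum>g\<in>arcs G. grover_entry G arev e g * (\<Sum>h\<in>arcs G. grover_entry G arev g h * grover_entry G arev h f))"

text \<open>If f = e^-1 then the head of f is the tail of e, so the cases of the definition merge
  into U = c T^t H - J with c = 2 / k.\<close>

lemma grover_entry_arcs:
  assumes "e \<in> arcs G" "f \<in> arcs G"
  shows "grover_entry G arev e f = 2 / k * of_bool (tail G e = head G f) - of_bool (f = arev e)"
proof -
  have "vertex_degree G arev (head G f) = k"
    using regular assms by (simp add: regular_def)
  then show ?thesis using assms by (auto simp: grover_entry_def)
qed

lemma sum_grover_entry:
  assumes e: "e \<in> arcs G"
  shows "(\<Sum>g\<in>arcs G. grover_entry G arev e g * \<phi> g) =
    2 / k * (\<Sum>g | g \<in> arcs G \<and> head G g = tail G e. \<phi> g) - \<phi> (arev e)"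
proof -
  have "(\<Sum>g\<in>arcs G. grover_entry G arev e g * \<phi> g) =
    (\<Sum>g\<in>arcs G. 2 / k * (if head G g = tail G e then \<phi> g else 0) - (if g = arev e then \<phi> g else 0))"
    by (rule sum.cong) (auto simp: grover_entry_arcs[OF e] algebra_simps)
  also have "\<dots> = 2 / k * (\<Sum>g\<in>arcs G. if head G g = tail G e then \<phi> g else 0)
      - (\<Sum>g\<in>arcs G. if g = arev e then \<phi> g else 0)"
    by (simp add: sum_subtractf sum_distrib_left del: sum_of_bool_eq)
  also have "(\<Sum>g\<in>arcs G. if g = arev e then \<phi> g else 0) = \<phi> (arev e)"
    using e by simp
  also have "(\<Sum>g\<in>arcs G. if head G g = tail G e then \<phi> g else 0) =
      (\<Sum>g | g \<in> arcs G \<and> head G g = tail G e. \<phi> g)"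
    by (simp add: sum.If_cases Int_def conj_commute)
  finally show ?thesis .
qed

text \<open>Expanding (c T^t H - J)^2 with H T^t = A, H J = T, J T^t = H^t and J^2 = 1 gives c^2 T^t
  A H - c T^t T - c H^t H + 1.\<close>

lemma grover_square:
  assumes e: "e \<in> arcs G" and f: "f \<in> arcs G"
  shows "(\<Sum>g\<in>arcs G. grover_entry G arev e g * grover_entry G arev g f) =
    (2 / k)\<^sup>2 * of_bool (adj (tail G e) (head G f)) - 2 / k * of_bool (tail G e = tail G f)
      - 2 / k * of_bool (head G e = head G f) + of_bool (e = f)"
proof -
  let ?I = "{g. g \<in> arcs G \<and> head G g = tail G e}"
  have "(\<Sum>g\<in>?I. grover_entry G arev g f) =
      (\<Sum>g\<in>?I. 2 / k * of_bool (head G f = tail G g) - (if g = arev f then 1 else 0))"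
    using f by (intro sum.cong) (auto simp: grover_entry_arcs)
  also have "\<dots> = 2 / k * (\<Sum>g\<in>?I. of_bool (head G f = tail G g)) - (\<Sum>g\<in>?I. if g = arev f then 1 else 0)"
    by (simp add: sum_subtractf sum_distrib_left del: sum_of_bool_eq)
  also have "(\<Sum>g\<in>?I. of_bool (head G f = tail G g)) = (of_bool (adj (tail G e) (head G f)) :: real)"
    unfolding sum_in_arcs[where \<phi> = "\<lambda>w. of_bool (head G f = w)"] sum_adj_eq ..
  also have "(\<Sum>g\<in>?I. if g = arev f then 1 else 0) = (of_bool (tail G e = tail G f) :: real)"
    using f by (subst sum.delta) auto
  finally have I: "(\<Sum>g\<in>?I. grover_entry G arev g f) =
      2 / k * of_bool (adj (tail G e) (head G f)) - of_bool (tail G e = tail G f)" .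
  have "grover_entry G arev (arev e) f = 2 / k * of_bool (head G e = head G f) - of_bool (e = f)"
    using e f by (auto simp: grover_entry_arcs)
  then show ?thesis
    unfolding sum_grover_entry[OF e] I by (simp add: power2_eq_square algebra_simps)
qed

text \<open>The square is multiplied by U = c T^t H - J from the left. The multiples of T^t H are -2
  c, from H H^t = k and c k = 2, and twice +c; they cancel.\<close>

lemma grover_cube_eq:
  assumes e: "e \<in> arcs G" and f: "f \<in> arcs G"
  shows "grover_cube e f =
    (2 / k) ^ 3 * card (common_nbrs (tail G e) (head G f))
      - (2 / k)\<^sup>2 * (of_bool (adj (tail G e) (tail G f)) + of_bool (adj (head G e) (head G f)))
      + 2 / k * of_bool (head G e = tail G f) - of_bool (f = arev e)"
proof -
  let ?I = "{g. g \<in> arcs G \<and> head G g = tail G e}"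
  let ?U2 = "\<lambda>g. \<Sum>h\<in>arcs G. grover_entry G arev g h * grover_entry G arev h f"
  have k: "k \<noteq> 0"
    using card_out_arcs[of "tail G e"] e by (metis (mono_tags, lifting) card_0_eq empty_iff finite_arcs
        finite_subset mem_Collect_eq subsetI tail_in_verts)
  have ck: "(2 / k) * real (card ?I) = 2"
    using card_in_arcs[of "tail G e"] e k by simp
  have "(\<Sum>g\<in>?I. ?U2 g) = (\<Sum>g\<in>?I. (2 / k)\<^sup>2 * of_bool (adj (tail G g) (head G f))
      - 2 / k * of_bool (tail G f = tail G g) - 2 / k * of_bool (tail G e = head G f)
      + (if g = f then 1 else 0))"
    using f by (intro sum.cong) (auto simp: grover_square)
  also have "\<dots> = (2 / k)\<^sup>2 * (\<Sum>g\<in>?I. of_bool (adj (tail G g) (head G f)))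
      - 2 / k * (\<Sum>g\<in>?I. of_bool (tail G f = tail G g))
      - card ?I * (2 / k * of_bool (tail G e = head G f))
      + (\<Sum>g\<in>?I. if g = f then 1 else 0)"
    by (simp add: sum_subtractf sum.distrib sum_distrib_left del: sum_of_bool_eq)
  also have "(\<Sum>g\<in>?I. of_bool (adj (tail G g) (head G f))) = real (card (common_nbrs (tail G e) (head G f)))"
    unfolding sum_in_arcs[where \<phi> = "\<lambda>w. of_bool (adj w (head G f))"] sum_adj_adj ..
  also have "(\<Sum>g\<in>?I. of_bool (tail G f = tail G g)) = (of_bool (adj (tail G e) (tail G f)) :: real)"
    unfolding sum_in_arcs[where \<phi> = "\<lambda>w. of_bool (tail G f = w)"] sum_adj_eq ..
  also have "(\<Sum>g\<in>?I. if g = f then 1 else 0) = (of_bool (tail G e = head G f) :: real)"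
    using f by (subst sum.delta) auto
  also have "card ?I * (2 / k * of_bool (tail G e = head G f)) = 2 * of_bool (tail G e = head G f)"
    using ck by (cases "tail G e = head G f") (auto simp: algebra_simps)
  finally have I: "(\<Sum>g\<in>?I. ?U2 g) =
      (2 / k)\<^sup>2 * card (common_nbrs (tail G e) (head G f)) - 2 / k * of_bool (adj (tail G e) (tail G f))
      - of_bool (tail G e = head G f)"
    by simp
  have "grover_cube e f = 2 / k * (\<Sum>g\<in>?I. ?U2 g) - ?U2 (arev e)"
    unfolding grover_cube_def using e by (rule sum_grover_entry)
  also have "?U2 (arev e) = (2 / k)\<^sup>2 * of_bool (adj (head G e) (head G f))
      - 2 / k * of_bool (head G e = tail G f) - 2 / k * of_bool (tail G e = head G f) + of_bool (f = arev e)"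
    using e f by (subst grover_square) auto
  finally show ?thesis
    unfolding I by (simp add: algebra_simps power2_eq_square power3_eq_cube)
qed

text \<open>A case analysis on the formula for U^3, whose right side is the (e, f) entry of Q R - 2
  J. Only 0 < c < 1 and c k = 2 are needed about c.\<close>

lemma grover_cube_support:
  assumes e: "e \<in> arcs G" and f: "f \<in> arcs G" and "k > 2"
  shows "(if grover_cube e f > 0 then 1 else 0) =
    (real (card (common_nbrs (tail G e) (head G f))) - of_bool (adj (tail G e) (tail G f))
      - (real k - 2) * of_bool (tail G e = head G f))
    + (2 * of_bool (head G e = tail G f) - of_bool (adj (head G e) (head G f)))
    - 2 * of_bool (f = arev e)"
proof -
  define c where "c = 2 / real k"
  have c: "0 < c" "c < 1" "c * k = 2"
    using \<open>k > 2\<close> by (auto simp: c_def)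
  note U3 = grover_cube_eq[OF e f, folded c_def]
  show ?thesis
  proof (cases "tail G e = head G f")
    case True
    have "adj (tail G e) (tail G f)" "adj (head G e) (head G f)"
      using adj_arc[OF e] adj_arc[OF f] adj_sym True by auto
    moreover have "head G e = tail G f \<longleftrightarrow> f = arev e"
      using True e f no_parallel[of f "arev e"] by auto
    \<comment> \<open>The A^2 term cancels both adjacency terms. What remains is (c - 1) [f = e^-1],
      which is never positive.\<close>
    moreover have "c ^ 3 * k = 2 * c\<^sup>2"
      using c by (simp add: power2_eq_square power3_eq_cube)
    ultimately show ?thesis
      using True c U3 e f card_common_nbrs_self by auto
  next
    case False
    then have "f \<noteq> arev e" using e by auto
    \<comment> \<open>Both are candidates for the middle vertex of a path of length 2 from
      \<open>tail G e\<close> to \<open>head G f\<close>; each needs one more adjacency to be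
      one.\<close>
    define x y where "x = tail G f" and "y = head G e"
    have x: "x \<in> common_nbrs (tail G e) (head G f)" if "adj (tail G e) x"
      using that adj_arc[OF f] adj_verts by (auto simp: common_nbrs_def x_def)
    have y: "y \<in> common_nbrs (tail G e) (head G f)" if "adj y (head G f)"
      using that adj_arc[OF e] adj_verts by (auto simp: common_nbrs_def y_def)
    have xy: "x = y" if "adj (tail G e) x" "adj y (head G f)"
      using x[OF that(1)] y[OF that(2)] False common_nbr_unique by (auto simp: common_nbrs_def)
    have yx: "adj (tail G e) x \<and> adj y (head G f)" if "x = y"
      using that adj_arc[OF e] adj_arc[OF f] by (auto simp: x_def y_def)
    have c3: "c ^ 3 < c\<^sup>2" "c\<^sup>2 < c" "c ^ 3 > 0"
      using c by (auto simp: power2_eq_square power3_eq_cube)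
    \<comment> \<open>This is the entry for x = y, where f continues e. If just one candidate is a
      common neighbour, the entry is c^3 - c^2 < 0; if none is, it is c^3 times the number of common
      neighbours.\<close>
    have "c ^ 3 - 2 * c\<^sup>2 + c = c * (1 - c)\<^sup>2"
      by (simp add: power2_eq_square power3_eq_cube algebra_simps)
    moreover have "c * (1 - c)\<^sup>2 > 0"
      using c by simp
    ultimately have pos: "c ^ 3 - 2 * c\<^sup>2 + c > 0" by simp
    have nn: "card (common_nbrs (tail G e) (head G f)) \<le> 1"
      using card_common_nbrs[OF False] by (metis card.empty ex_in_conv le_refl zero_le_one)
    show ?thesis
      using U3 False \<open>f \<noteq> arev e\<close> card_common_nbrs[OF False, OF x] card_common_nbrs[OF False, OF y] 
        xy yx pos c3 nn unfolding x_def[symmetric] y_def[symmetric]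
      by (cases "adj (tail G e) x"; cases "adj y (head G f)"; cases "x = y";
         cases "card (common_nbrs (tail G e) (head G f)) = 0") (auto simp: le_Suc_eq)
  qed
qed

end

section \<open>Enumerations of vertices and arcs\<close>

lemma index_mult_mat_sum:
  assumes "P \<in> carrier_mat nr n" "R \<in> carrier_mat n nc" "i < nr" "j < nc"
  shows "(P * R) $$ (i, j) = (\<Sum>l<n. P $$ (i, l) * R $$ (l, j))"
  using assms by (auto simp: scalar_prod_def lessThan_atLeast0)

lemma sum_lessThan_add:
  fixes a b :: nat
  shows "(\<Sum>l<a + b. \<phi> l) = (\<Sum>l<a. \<phi> l) + (\<Sum>l<b. \<phi> (a + l) :: 'r :: comm_monoid_add)"
  by (induction b) (simp_all add: ac_simps)

locale enumerated_graph = sparse_regular_graph +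
  fixes vs :: "'a list" and es :: "'b list"
  assumes distinct_vs: "distinct vs" and set_vs: "set vs = verts G"
    and distinct_es: "distinct es" and set_es: "set es = arcs G"
    and k_gt_2: "k > 2"
begin

abbreviation n where "n \<equiv> length vs"
abbreviation N where "N \<equiv> length es"
abbreviation X :: "real poly" where "X \<equiv> [:0, 1:]"

lemma vs_nth[simp]: "i < n \<Longrightarrow> vs ! i \<in> verts G"
  using set_vs nth_mem by blast

lemma es_nth[simp]: "i < N \<Longrightarrow> es ! i \<in> arcs G"
  using set_es nth_mem by blast

lemma vs_eq_iff[simp]: "i < n \<Longrightarrow> j < n \<Longrightarrow> vs ! i = vs ! j \<longleftrightarrow> i = j"
  by (rule nth_eq_iff_index_eq[OF distinct_vs])

lemma es_eq_iff[simp]: "i < N \<Longrightarrow> j < N \<Longrightarrow> es ! i = es ! j \<longleftrightarrow> i = j"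
  by (rule nth_eq_iff_index_eq[OF distinct_es])

lemma sum_vs: "(\<Sum>i<n. \<phi> (vs ! i)) = (\<Sum>v\<in>verts G. \<phi> v)"
  by (rule sum.reindex_bij_betw[OF bij_betw_nth[OF distinct_vs]]) (auto simp: set_vs)

lemma sum_es: "(\<Sum>i<N. \<phi> (es ! i)) = (\<Sum>e\<in>arcs G. \<phi> e)"
  by (rule sum.reindex_bij_betw[OF bij_betw_nth[OF distinct_es]]) (auto simp: set_es)

lemma sum_vs_delta:
  assumes "u \<in> verts G"
  shows "(\<Sum>i<n. of_bool (u = vs ! i) * \<phi> (vs ! i)) = (\<phi> u :: 'r :: semiring_1)"
proof -
  have "(\<Sum>i<n. of_bool (u = vs ! i) * \<phi> (vs ! i)) = (\<Sum>v\<in>verts G. if v = u then \<phi> v else 0)"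
    unfolding sum_vs[where \<phi> = "\<lambda>v. of_bool (u = v) * \<phi> v"] by (rule sum.cong) auto
  then show ?thesis using assms by simp
qed

lemma n_eq: "n = card (verts G)"
  using distinct_card[OF distinct_vs] set_vs by simp

lemma N_eq: "N = 2 * card (edges G arev)"
  using distinct_card[OF distinct_es] set_es card_arcs by simp

text \<open>From 2 m = k n and k > 2. It makes the exponent m - n a genuine difference of natural
  numbers.\<close>

lemma n_le: "n \<le> card (edges G arev)"
proof -
  have "2 * card (edges G arev) = k * n"
    using card_arcs card_arcs_regular n_eq by simp
  also have "\<dots> \<ge> 2 * n"
    using k_gt_2 by (intro mult_right_mono) auto
  finally show ?thesis by simp
qed

text \<open>The matrix power sums over indices and \<open>grover_cube\<close> over arcs;
  \<open>sum_es\<close> translates between them.\<close>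

lemma grover_matrix_cube:
  assumes "i < N" "j < N"
  shows "(grover_matrix G arev es ^\<^sub>m 3) $$ (i, j) = grover_cube (es ! i) (es ! j)"
proof -
  let ?U = "grover_matrix G arev es"
  have U: "?U \<in> carrier_mat N N"
    by (simp add: grover_matrix_def)
  have "?U ^\<^sub>m 3 = ?U * (?U * ?U)"
    using U by (simp add: numeral_eq_Suc assoc_mult_mat[OF U U U])
  moreover have "(?U * ?U) $$ (l, j) =
      (\<Sum>h\<in>arcs G. grover_entry G arev (es ! l) h * grover_entry G arev h (es ! j))" if "l < N" for l
    using that assms unfolding sum_es[symmetric]
    by (subst index_mult_mat_sum[OF U U]) (auto simp: grover_matrix_def)
  ultimately show ?thesis
    using assms unfolding grover_cube_def sum_es[symmetric]
    by (simp add: index_mult_mat_sum[OF U mult_carrier_mat[OF U U]] del: index_mult_mat(1))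
      (simp add: grover_matrix_def)
qed

text \<open>Arc reversal carried over to positions in \<open>es\<close>; the description is unique
  as \<open>es\<close> is distinct.\<close>

definition opp :: "nat \<Rightarrow> nat" where
  "opp i = (THE j. j < N \<and> es ! j = arev (es ! i))"

lemma opp:
  assumes "i < N"
  shows "opp i < N" "es ! opp i = arev (es ! i)"
proof -
  have "arev (es ! i) \<in> set es"
    using assms set_es by simp
  then obtain j where "j < N" "es ! j = arev (es ! i)"
    by (metis in_set_conv_nth)
  then have "\<exists>!j. j < N \<and> es ! j = arev (es ! i)"
    using es_eq_iff by metis
  then have "opp i < N \<and> es ! opp i = arev (es ! i)"
    unfolding opp_def by (rule theI')
  then show "opp i < N" "es ! opp i = arev (es ! i)" by auto
qed

lemma opp_neq: "i < N \<Longrightarrow> opp i \<noteq> i"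
  using opp(2) arev_neq es_nth by metis

lemma opp_eq_iff: "i < N \<Longrightarrow> j < N \<Longrightarrow> j = opp i \<longleftrightarrow> es ! j = arev (es ! i)"
  using opp es_eq_iff by metis

section \<open>Factorization of the characteristic matrix\<close>

definition adj_mat :: "real poly mat" where
  "adj_mat = mat n n (\<lambda>(i, j). of_bool (adj (vs ! i) (vs ! j)))"

text \<open>\<open>incidence_mat\<close>, \<open>coeff_mat\<close>, \<open>shift_mat\<close> and
  \<open>arev_mat\<close> play the roles of Q, R, S and Z = \<lambda> + 2 J in
  \<open>det_diff_mult\<close>.\<close>

definition incidence_mat :: "real poly mat" where
  "incidence_mat = mat N (n + n) (\<lambda>(i, j).
     if j < n then of_bool (tail G (es ! i) = vs ! j) else of_bool (head G (es ! i) = vs ! (j - n)))"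

text \<open>
  These are the entries of \<open>A\<^sup>2 H - A T - (k - 2) H\<close> and \<open>2 T - A H\<close>, since \<open>card (common_nbrs u v)\<close> is the
  \<open>(u, v)\<close> entry of \<open>A\<^sup>2\<close>.
\<close>

definition tail_coeff :: "'a \<Rightarrow> 'b \<Rightarrow> real poly" where
  "tail_coeff u f = of_nat (card (common_nbrs u (head G f))) - of_bool (adj u (tail G f))
     - (of_nat k - 2) * of_bool (u = head G f)"

definition head_coeff :: "'a \<Rightarrow> 'b \<Rightarrow> real poly" where
  "head_coeff u f = 2 * of_bool (u = tail G f) - of_bool (adj u (head G f))"

definition coeff_mat :: "real poly mat" where
  "coeff_mat = mat (n + n) N (\<lambda>(i, j).
     if i < n then tail_coeff (vs ! i) (es ! j) else head_coeff (vs ! (i - n)) (es ! j))"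

definition shift_mat :: "real poly mat" where
  "shift_mat = four_block_mat (X \<cdot>\<^sub>m 1\<^sub>m n) (2 \<cdot>\<^sub>m 1\<^sub>m n) (2 \<cdot>\<^sub>m 1\<^sub>m n) (X \<cdot>\<^sub>m 1\<^sub>m n)"

definition arev_mat :: "real poly mat" where
  "arev_mat = mat N N (\<lambda>(i, j). if i = j then X else if j = opp i then 2 else 0)"

lemma carriers[simp]:
  "adj_mat \<in> carrier_mat n n" "incidence_mat \<in> carrier_mat N (n + n)"
  "coeff_mat \<in> carrier_mat (n + n) N" "shift_mat \<in> carrier_mat (n + n) (n + n)"
  "arev_mat \<in> carrier_mat N N"
  by (auto simp: adj_mat_def incidence_mat_def coeff_mat_def shift_mat_def arev_mat_def)

lemma dims[simp]:
  "dim_row adj_mat = n" "dim_col adj_mat = n" "dim_row incidence_mat = N" "dim_col incidence_mat = n + n"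
  "dim_row coeff_mat = n + n" "dim_col coeff_mat = N" "dim_row shift_mat = n + n" "dim_col shift_mat = n + n"
  "dim_row arev_mat = N" "dim_col arev_mat = N"
  using carriers by (metis carrier_matD)+

text \<open>Each row of Q has a single 1 in either half, which picks one row from each half of
  R.\<close>

lemma incidence_mult_coeff:
  assumes "i < N" "j < N"
  shows "(incidence_mat * coeff_mat) $$ (i, j) =
    tail_coeff (tail G (es ! i)) (es ! j) + head_coeff (head G (es ! i)) (es ! j)"
proof -
  have "(incidence_mat * coeff_mat) $$ (i, j) =
     (\<Sum>l<n. of_bool (tail G (es ! i) = vs ! l) * tail_coeff (vs ! l) (es ! j))
     + (\<Sum>l<n. of_bool (head G (es ! i) = vs ! l) * head_coeff (vs ! l) (es ! j))"
    using assms
    by (simp add: index_mult_mat_sum[OF carriers(2,3)] del: index_mult_mat(1))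
      (simp add: incidence_mat_def coeff_mat_def sum_lessThan_add)
  then show ?thesis
    using assms
      sum_vs_delta[where u = "tail G (es ! i)" and \<phi> = "\<lambda>v. tail_coeff v (es ! j)"]
      sum_vs_delta[where u = "head G (es ! i)" and \<phi> = "\<lambda>v. head_coeff v (es ! j)"]
    by simp
qed

text \<open>The support is Q R - 2 J by \<open>grover_cube_support\<close>, so subtracting it from
  \<lambda> leaves (\<lambda> + 2 J) - Q R.\<close>

lemma char_poly_matrix_cube_support:
  "char_poly_matrix (positive_support (grover_matrix G arev es ^\<^sub>m 3)) = arev_mat - incidence_mat * coeff_mat"
  (is "char_poly_matrix ?M = _")
proof (rule eq_matI)
  interpret c: comm_ring_hom "\<lambda>a :: real. [:a:]"
    by unfold_locales auto
  have lift: "[:of_bool P:] = (of_bool P :: real poly)" "[:real l:] = of_nat l" for P l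
    by (simp_all add: of_nat_poly)
  fix i j assume "i < dim_row (arev_mat - incidence_mat * coeff_mat)"
    "j < dim_col (arev_mat - incidence_mat * coeff_mat)"
  then have ij: "i < N" "j < N"
    using carriers by auto
  have dim: "dim_row (grover_matrix G arev es) = N" "dim_col (grover_matrix G arev es) = N"
    by (simp_all add: grover_matrix_def)
  have "?M $$ (i, j) = (if grover_cube (es ! i) (es ! j) > 0 then 1 else 0)"
    using ij by (simp add: positive_support_def dim grover_matrix_cube)
  then have "[: ?M $$ (i, j) :] =
      tail_coeff (tail G (es ! i)) (es ! j) + head_coeff (head G (es ! i)) (es ! j)
      - 2 * of_bool (j = opp i)"
    unfolding grover_cube_support[OF es_nth[OF ij(1)] es_nth[OF ij(2)] k_gt_2] tail_coeff_def head_coeff_def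
      opp_eq_iff[OF ij]
    by (simp only: c.hom_add c.hom_minus c.hom_mult lift flip: numeral_poly)
  \<comment> \<open>Needed because \<open>arev_mat\<close> tests i = j first: on the diagonal there
    must be no 2 to account for.\<close>
  moreover have "opp i \<noteq> i"
    using ij(1) by (rule opp_neq)
  moreover have "char_poly_matrix ?M $$ (i, j) = (if i = j then X else 0) - [:?M $$ (i, j):]"
    unfolding c.hom_uminus[symmetric] diff_conv_add_uminus
    using ij by (auto simp: char_poly_matrix_def positive_support_def dim)
  moreover have "(arev_mat - incidence_mat * coeff_mat) $$ (i, j) =
      arev_mat $$ (i, j) - (incidence_mat * coeff_mat) $$ (i, j)"
    using ij by (intro index_minus_mat) simp_all
  ultimately show "char_poly_matrix ?M $$ (i, j) = (arev_mat - incidence_mat * coeff_mat) $$ (i, j)"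
    using ij unfolding incidence_mult_coeff[OF ij] by (auto simp: arev_mat_def)
qed (auto simp: char_poly_matrix_def positive_support_def grover_matrix_def)

text \<open>Row \<open>opp i\<close> of Q is row i with its halves exchanged, since reversal swaps
  tail and head.\<close>

lemma arev_mult_incidence: "arev_mat * incidence_mat = incidence_mat * shift_mat"
proof (rule eq_matI)
  fix i j assume "i < dim_row (incidence_mat * shift_mat)" "j < dim_col (incidence_mat * shift_mat)"
  then have ij: "i < N" "j < n + n"
    by simp_all
  have "(arev_mat * incidence_mat) $$ (i, j) = (\<Sum>l<N. arev_mat $$ (i, l) * incidence_mat $$ (l, j))"
    using ij by (intro index_mult_mat_sum) simp_all
  also have "\<dots> = (\<Sum>l\<in>{i, opp i}. arev_mat $$ (i, l) * incidence_mat $$ (l, j))"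
    using ij opp[OF ij(1)] by (intro sum.mono_neutral_right) (auto simp: arev_mat_def)
  also have "\<dots> = X * incidence_mat $$ (i, j) + 2 * incidence_mat $$ (opp i, j)"
    using ij opp[OF ij(1)] opp_neq[OF ij(1)] by (subst sum.insert) (auto simp: arev_mat_def)
  also have "\<dots> = (incidence_mat * shift_mat) $$ (i, j)"
  proof -
    have "(incidence_mat * shift_mat) $$ (i, j) = (\<Sum>l<n + n. incidence_mat $$ (i, l) * shift_mat $$ (l, j))"
      using ij by (intro index_mult_mat_sum) simp_all
    also have "\<dots> = (\<Sum>l<n. of_bool (tail G (es ! i) = vs ! l) * (if j < n then if l = j then X else 0 else if l = j - n then 2 else 0))
       + (\<Sum>l<n. of_bool (head G (es ! i) = vs ! l) * (if j < n then if l = j then 2 else 0 else if l = j - n then X else 0))"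
      unfolding sum_lessThan_add using ij
      by (intro arg_cong2[where f = plus] sum.cong) (auto simp: incidence_mat_def shift_mat_def)
    also have "\<dots> = X * incidence_mat $$ (i, j) + 2 * incidence_mat $$ (opp i, j)"
    proof (cases "j < n")
      case True
      \<comment> \<open>Moving the indicator into the conditional lets the sum collapse to its one
        term with l = j.\<close>
      have "of_bool P * (if l = j then z else 0) = (if l = j then of_bool P * z else 0)" for P l and z :: "real poly"
        by simp
      with True show ?thesis
        using ij opp[OF ij(1)] by (simp add: incidence_mat_def del: sum_of_bool_mult_eq)
    next
      case False
      have "of_bool P * (if l = j - n then z else 0) = (if l = j - n then of_bool P * z else 0)" for P l and z :: "real poly"
        by simp
      moreover have "j - n < n" using False ij by simp
      ultimately show ?thesis
        using False ij opp[OF ij(1)] by (simp add: incidence_mat_def del: sum_of_bool_mult_eq)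
    qed
    finally show ?thesis ..
  qed
  finally show "(arev_mat * incidence_mat) $$ (i, j) = (incidence_mat * shift_mat) $$ (i, j)" .
qed simp_all

section \<open>Determinants of Z and S\<close>

lemma det_arev_mat: "det arev_mat = (X\<^sup>2 - 4) ^ card (edges G arev)"
  unfolding arev_mat_def N_eq
proof (rule det_fixfree_involution)
  fix i assume "i < 2 * card (edges G arev)"
  then have i: "i < N" by (simp add: N_eq)
  have "opp (opp i) = i"
    using opp[OF i] opp[of "opp i"] i es_eq_iff by (metis arev_arev)
  moreover have "opp i \<noteq> i"
    using i by (rule opp_neq)
  ultimately show "opp i < 2 * card (edges G arev) \<and> opp (opp i) = i \<and> opp i \<noteq> i"
    using opp[OF i] by (simp add: N_eq)
qed

lemma det_shift_mat: "det shift_mat = (X\<^sup>2 - 4) ^ n"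
proof -
  have "det shift_mat = det ((X \<cdot>\<^sub>m 1\<^sub>m n) * (X \<cdot>\<^sub>m 1\<^sub>m n) - (2 \<cdot>\<^sub>m 1\<^sub>m n) * (2 \<cdot>\<^sub>m 1\<^sub>m n))"
    unfolding shift_mat_def by (rule det_four_block_mat[of _ n]) (auto intro!: eq_matI)
  also have "(X \<cdot>\<^sub>m 1\<^sub>m n) * (X \<cdot>\<^sub>m 1\<^sub>m n) - (2 \<cdot>\<^sub>m 1\<^sub>m n) * (2 \<cdot>\<^sub>m 1\<^sub>m n) = (X\<^sup>2 - 4) \<cdot>\<^sub>m 1\<^sub>m n"
    by (auto intro!: eq_matI simp: power2_eq_square)
  finally show ?thesis by simp
qed

section \<open>The blocks of S - R Q as polynomials in A\<close>

lemma adj_mat_index: "i < n \<Longrightarrow> j < n \<Longrightarrow> adj_mat $$ (i, j) = of_bool (adj (vs ! i) (vs ! j))"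
  by (simp add: adj_mat_def)

lemma adj_mat_square:
  assumes "i < n" "j < n"
  shows "(adj_mat ^\<^sub>m 2) $$ (i, j) = of_nat (card (common_nbrs (vs ! i) (vs ! j)))"
proof -
  have "adj_mat ^\<^sub>m 2 = adj_mat * adj_mat"
    using left_mult_one_mat[OF carriers(1)] by (simp add: numeral_eq_Suc adj_mat_def)
  then have "(adj_mat ^\<^sub>m 2) $$ (i, j) = (\<Sum>l<n. adj_mat $$ (i, l) * adj_mat $$ (l, j))"
    using assms by (simp only: index_mult_mat_sum[OF carriers(1) carriers(1)])
  also have "\<dots> = (\<Sum>l<n. of_bool (adj (vs ! i) (vs ! l)) * of_bool (adj (vs ! l) (vs ! j)))"
    using assms by (intro sum.cong) (auto simp: adj_mat_index)
  also have "\<dots> = of_nat (card (common_nbrs (vs ! i) (vs ! j)))"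
    unfolding sum_vs[where \<phi> = "\<lambda>w. of_bool (adj (vs ! i) w) * of_bool (adj w (vs ! j))"] sum_adj_adj ..
  finally show ?thesis .
qed

text \<open>Stated as a sum over the neighbours of the column vertex, the form in which
  \<open>tail_coeff_tail\<close> produces A^3.\<close>

lemma adj_mat_cube:
  assumes "i < n" "j < n"
  shows "(adj_mat ^\<^sub>m 3) $$ (i, j) =
    (\<Sum>w\<in>verts G. of_bool (adj (vs ! j) w) * of_nat (card (common_nbrs (vs ! i) w)))"
proof -
  have "adj_mat ^\<^sub>m 3 = adj_mat ^\<^sub>m 2 * adj_mat"
    by (simp add: numeral_eq_Suc)
  then have "(adj_mat ^\<^sub>m 3) $$ (i, j) = (\<Sum>l<n. (adj_mat ^\<^sub>m 2) $$ (i, l) * adj_mat $$ (l, j))"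
    using assms by (simp only: index_mult_mat_sum[OF pow_carrier_mat[OF carriers(1)] carriers(1)])
  also have "\<dots> = (\<Sum>l<n. of_bool (adj (vs ! j) (vs ! l)) * of_nat (card (common_nbrs (vs ! i) (vs ! l))))"
    using assms adj_sym by (intro sum.cong) (auto simp: adj_mat_square adj_mat_index)
  also have "\<dots> = (\<Sum>w\<in>verts G. of_bool (adj (vs ! j) w) * of_nat (card (common_nbrs (vs ! i) w)))"
    by (rule sum_vs)
  finally show ?thesis .
qed

lemma sum_of_bool_filter:
  "(\<Sum>e\<in>arcs G. \<phi> e * of_bool (P e)) = (\<Sum>e | e \<in> arcs G \<and> P e. \<phi> e :: 'r :: comm_semiring_1)"
  by (rule sum.mono_neutral_cong_right) auto

text \<open>The upper left block of R Q: H T^t = A and T T^t = k turn (A^2 H - A T - (k - 2) H) T^t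
  into A^3 - 2 (k - 1) A.\<close>

lemma tail_coeff_tail:
  assumes "v \<in> verts G"
  shows "(\<Sum>f\<in>arcs G. tail_coeff u f * of_bool (tail G f = v)) =
    (\<Sum>w\<in>verts G. of_bool (adj v w) * of_nat (card (common_nbrs u w))) - 2 * (of_nat k - 1) * of_bool (adj u v)"
proof -
  have "(\<Sum>f\<in>arcs G. tail_coeff u f * of_bool (tail G f = v)) =
      (\<Sum>f | f \<in> arcs G \<and> tail G f = v. of_nat (card (common_nbrs u (head G f))) - of_bool (adj u v)
        - (of_nat k - 2) * of_bool (u = head G f))"
    unfolding sum_of_bool_filter by (rule sum.cong) (auto simp: tail_coeff_def)
  also have "\<dots> = (\<Sum>f | f \<in> arcs G \<and> tail G f = v. of_nat (card (common_nbrs u (head G f))))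
      - of_nat k * of_bool (adj u v) - (of_nat k - 2) * (\<Sum>f | f \<in> arcs G \<and> tail G f = v. of_bool (u = head G f))"
    by (simp add: sum_subtractf sum_distrib_left card_out_arcs[OF assms] del: sum_of_bool_eq)
  also have "(\<Sum>f | f \<in> arcs G \<and> tail G f = v. of_bool (u = head G f)) = (of_bool (adj u v) :: real poly)"
    unfolding sum_out_arcs[where \<phi> = "\<lambda>w. of_bool (u = w)"] sum_adj_eq using adj_sym by simp
  finally show ?thesis
    unfolding sum_out_arcs[where \<phi> = "\<lambda>w. of_nat (card (common_nbrs u w))"] by (simp add: algebra_simps)
qed

text \<open>The upper right block, by H H^t = k and T H^t = A.\<close>

lemma tail_coeff_head:
  assumes "v \<in> verts G"
  shows "(\<Sum>f\<in>arcs G. tail_coeff u f * of_bool (head G f = v)) =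
    (of_nat k - 1) * of_nat (card (common_nbrs u v)) - of_nat k * (of_nat k - 2) * of_bool (u = v)"
proof -
  have "(\<Sum>f\<in>arcs G. tail_coeff u f * of_bool (head G f = v)) =
      (\<Sum>f | f \<in> arcs G \<and> head G f = v. of_nat (card (common_nbrs u v)) - of_bool (adj (tail G f) u)
        - (of_nat k - 2) * of_bool (u = v))"
    unfolding sum_of_bool_filter using adj_sym by (intro sum.cong) (auto simp: tail_coeff_def)
  also have "\<dots> = of_nat k * of_nat (card (common_nbrs u v))
      - (\<Sum>f | f \<in> arcs G \<and> head G f = v. of_bool (adj (tail G f) u)) - of_nat k * ((of_nat k - 2) * of_bool (u = v))"
    by (simp add: sum_subtractf card_in_arcs[OF assms] del: sum_of_bool_eq)
  also have "(\<Sum>f | f \<in> arcs G \<and> head G f = v. of_bool (adj (tail G f) u)) =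
      (of_nat (card (common_nbrs u v)) :: real poly)"
    unfolding sum_in_arcs[where \<phi> = "\<lambda>w. of_bool (adj w u)"] sum_adj_adj
    by (simp only: card_common_nbrs_commute)
  finally show ?thesis by (simp add: algebra_simps)
qed

text \<open>The lower left block: (2 T - A H) T^t = 2 k - A^2.\<close>

lemma head_coeff_tail:
  assumes "v \<in> verts G"
  shows "(\<Sum>f\<in>arcs G. head_coeff u f * of_bool (tail G f = v)) =
    2 * of_nat k * of_bool (u = v) - of_nat (card (common_nbrs u v))"
proof -
  have "(\<Sum>f\<in>arcs G. head_coeff u f * of_bool (tail G f = v)) =
      (\<Sum>f | f \<in> arcs G \<and> tail G f = v. 2 * of_bool (u = v) - of_bool (adj (head G f) u))"
    unfolding sum_of_bool_filter using adj_sym by (intro sum.cong) (auto simp: head_coeff_def)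
  also have "\<dots> = of_nat k * (2 * of_bool (u = v)) - (\<Sum>f | f \<in> arcs G \<and> tail G f = v. of_bool (adj (head G f) u))"
    by (simp add: sum_subtractf card_out_arcs[OF assms] del: sum_of_bool_eq)
  also have "(\<Sum>f | f \<in> arcs G \<and> tail G f = v. of_bool (adj (head G f) u)) =
      (of_nat (card (common_nbrs u v)) :: real poly)"
    unfolding sum_out_arcs[where \<phi> = "\<lambda>w. of_bool (adj w u)"] sum_adj_adj
    by (simp only: card_common_nbrs_commute)
  finally show ?thesis by (simp add: algebra_simps)
qed

text \<open>The lower right block: (2 T - A H) H^t = 2 A - k A.\<close>

lemma head_coeff_head:
  assumes "v \<in> verts G"
  shows "(\<Sum>f\<in>arcs G. head_coeff u f * of_bool (head G f = v)) = (2 - of_nat k) * of_bool (adj u v)"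
proof -
  have "(\<Sum>f\<in>arcs G. head_coeff u f * of_bool (head G f = v)) =
      (\<Sum>f | f \<in> arcs G \<and> head G f = v. 2 * of_bool (u = tail G f) - of_bool (adj u v))"
    unfolding sum_of_bool_filter by (intro sum.cong) (auto simp: head_coeff_def)
  also have "\<dots> = 2 * (\<Sum>f | f \<in> arcs G \<and> head G f = v. of_bool (u = tail G f)) - of_nat k * of_bool (adj u v)"
    by (simp add: sum_subtractf sum_distrib_left card_in_arcs[OF assms] del: sum_of_bool_eq)
  also have "(\<Sum>f | f \<in> arcs G \<and> head G f = v. of_bool (u = tail G f)) = (of_bool (adj u v) :: real poly)"
    unfolding sum_in_arcs[where \<phi> = "\<lambda>w. of_bool (u = w)"] sum_adj_eq using adj_sym by simp
  finally show ?thesis by (simp add: algebra_simps)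
qed

text \<open>The four block sums are subtracted from S and rewritten for
  \<open>det_adjacency_blocks\<close>, using 2 + k (k - 2) = q^2 + 1, 2 - 2 k = -2 q and k - 2 = q -
  1.\<close>

lemma shift_minus_coeff_mult_incidence:
  defines "q \<equiv> of_nat k - 1 :: real poly"
  shows "shift_mat - coeff_mat * incidence_mat = four_block_mat
      (X \<cdot>\<^sub>m 1\<^sub>m n - (adj_mat ^\<^sub>m 3 - (2 * q) \<cdot>\<^sub>m adj_mat)) ((q\<^sup>2 + 1) \<cdot>\<^sub>m 1\<^sub>m n - q \<cdot>\<^sub>m adj_mat ^\<^sub>m 2)
      (adj_mat ^\<^sub>m 2 - (2 * q) \<cdot>\<^sub>m 1\<^sub>m n) (X \<cdot>\<^sub>m 1\<^sub>m n + (q - 1) \<cdot>\<^sub>m adj_mat)"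
  (is "_ = ?F")
proof (rule eq_matI)
  fix i j assume "i < dim_row ?F" "j < dim_col ?F"
  then have ij: "i < n + n" "j < n + n"
    by auto
  define r where "r = (\<lambda>f. if i < n then tail_coeff (vs ! i) f else head_coeff (vs ! (i - n)) f)"
  define c where "c = (\<lambda>f. if j < n then of_bool (tail G f = vs ! j) else of_bool (head G f = vs ! (j - n)) :: real poly)"
  have "(coeff_mat * incidence_mat) $$ (i, j) = (\<Sum>l<N. r (es ! l) * c (es ! l))"
    unfolding index_mult_mat_sum[OF carriers(3,2) ij] using ij
    by (intro sum.cong) (auto simp: coeff_mat_def incidence_mat_def r_def c_def)
  also have "\<dots> = (\<Sum>f\<in>arcs G. r f * c f)"
    by (rule sum_es)
  finally have *: "(coeff_mat * incidence_mat) $$ (i, j) = (\<Sum>f\<in>arcs G. r f * c f)" .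
  consider (tt) "i < n" "j < n" | (th) "i < n" "j \<ge> n" "j - n < n"
    | (ht) "i \<ge> n" "i - n < n" "j < n" | (hh) "i \<ge> n" "i - n < n" "j \<ge> n" "j - n < n"
    using ij by linarith
  then have "shift_mat $$ (i, j) - (\<Sum>f\<in>arcs G. r f * c f) = ?F $$ (i, j)"
  proof cases
    case tt
    then have "(\<Sum>f\<in>arcs G. r f * c f) = (adj_mat ^\<^sub>m 3) $$ (i, j) - 2 * q * adj_mat $$ (i, j)"
      by (simp add: r_def c_def tail_coeff_tail adj_mat_cube adj_mat_index q_def del: sum_mult_of_bool_eq)
    with tt show ?thesis by (simp add: shift_mat_def)
  next
    case th
    then have "(\<Sum>f\<in>arcs G. r f * c f) =
        q * (adj_mat ^\<^sub>m 2) $$ (i, j - n) - of_nat k * (of_nat k - 2) * of_bool (i = j - n)"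
      by (simp add: r_def c_def tail_coeff_head adj_mat_square q_def del: sum_mult_of_bool_eq)
    with th show ?thesis
      by (cases "i = j - n") (simp_all add: shift_mat_def q_def power2_eq_square algebra_simps)
  next
    case ht
    then have "(\<Sum>f\<in>arcs G. r f * c f) =
        2 * of_nat k * of_bool (i - n = j) - (adj_mat ^\<^sub>m 2) $$ (i - n, j)"
      by (simp add: r_def c_def head_coeff_tail adj_mat_square del: sum_mult_of_bool_eq)
    with ht show ?thesis
      by (cases "i - n = j") (simp_all add: shift_mat_def q_def algebra_simps)
  next
    case hh
    then have "(\<Sum>f\<in>arcs G. r f * c f) = (2 - of_nat k) * adj_mat $$ (i - n, j - n)"
      by (simp add: r_def c_def head_coeff_head adj_mat_index del: sum_mult_of_bool_eq)
    with hh show ?thesis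
      by (cases "i - n = j - n") (simp_all add: shift_mat_def q_def algebra_simps)
  qed
  moreover have "(shift_mat - coeff_mat * incidence_mat) $$ (i, j) =
      shift_mat $$ (i, j) - (coeff_mat * incidence_mat) $$ (i, j)"
    using ij by (intro index_minus_mat) simp_all
  ultimately show "(shift_mat - coeff_mat * incidence_mat) $$ (i, j) = ?F $$ (i, j)"
    using * by simp
qed simp_all

section \<open>Return to real matrices and the characteristic polynomial\<close>

lemma const_poly_mat_adjacency: "const_poly_mat (adjacency_matrix G arev vs) = adj_mat"
  by (auto simp: const_poly_mat_def adjacency_matrix_def adj_mat_def card_edges_between of_bool_def
      intro!: eq_matI)

theorem char_poly_cube_support:
  defines "A \<equiv> adjacency_matrix G arev vs"
  shows "char_poly (positive_support (grover_matrix G arev es ^\<^sub>m 3)) =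
        (X\<^sup>2 - 4) ^ (card (edges G arev) - n) *
        det (X\<^sup>2 \<cdot>\<^sub>m 1\<^sub>m n
             - X \<cdot>\<^sub>m const_poly_mat (A ^\<^sub>m 3 - (3 * real k - 4) \<cdot>\<^sub>m A)
             + const_poly_mat (A ^\<^sub>m 4 - (real k)\<^sup>2 \<cdot>\<^sub>m A ^\<^sub>m 2
                 + (2 * (real k - 1) * ((real k)\<^sup>2 - 2 * real k + 2)) \<cdot>\<^sub>m 1\<^sub>m n))"
    (is "?p = _ * det ?D")
proof -
  interpret c: comm_ring_hom "\<lambda>a :: real. [:a:]"
    by unfold_locales auto
  let ?m = "card (edges G arev)"
  define q :: "real poly" where "q = of_nat k - 1"
  have A: "A \<in> carrier_mat n n"
    by (simp add: A_def adjacency_matrix_def)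
  have dim: "dim_row A = n" "dim_col A = n"
    using A by simp_all
  have B: "const_poly_mat A = adj_mat"
    unfolding A_def by (rule const_poly_mat_adjacency)
  have pow: "const_poly_mat (A ^\<^sub>m i) = adj_mat ^\<^sub>m i" for i
    unfolding B[symmetric] unfolding const_poly_mat_def by (rule c.mat_hom_pow[OF A])
  have entry: "[:(A ^\<^sub>m i) $$ (a, b):] = (adj_mat ^\<^sub>m i) $$ (a, b)" "[:A $$ (a, b):] = adj_mat $$ (a, b)"
    if "a < n" "b < n" for i a b
    using that dim arg_cong[OF pow, of "\<lambda>M. M $$ (a, b)" i] arg_cong[OF B, of "\<lambda>M. M $$ (a, b)"]
    by (auto simp: const_poly_mat_def)
  have q: "q = [:real k - 1:]"
    unfolding q_def c.hom_minus c.hom_one by (simp add: of_nat_poly)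
  note lift = numeral_poly power2_eq_square c.hom_one[symmetric] c.hom_mult[symmetric]
    c.hom_add[symmetric] c.hom_minus[symmetric]
  have lift1: "const_poly_mat (A ^\<^sub>m 3 - (3 * real k - 4) \<cdot>\<^sub>m A) = adj_mat ^\<^sub>m 3 - (3 * q - 1) \<cdot>\<^sub>m adj_mat"
  proof -
    have "3 * q - 1 = [:3 * real k - 4:]"
      unfolding q lift by simp
    then show ?thesis
      by (auto simp: const_poly_mat_def dim simp flip: entry intro!: eq_matI)
  qed
  have lift2: "const_poly_mat (A ^\<^sub>m 4 - (real k)\<^sup>2 \<cdot>\<^sub>m A ^\<^sub>m 2
        + (2 * (real k - 1) * ((real k)\<^sup>2 - 2 * real k + 2)) \<cdot>\<^sub>m 1\<^sub>m n)
      = adj_mat ^\<^sub>m 4 - (q + 1)\<^sup>2 \<cdot>\<^sub>m adj_mat ^\<^sub>m 2 + (2 * q * (q\<^sup>2 + 1)) \<cdot>\<^sub>m 1\<^sub>m n"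
  proof -
    have "(q + 1)\<^sup>2 = [:(real k)\<^sup>2:]"
      "2 * q * (q\<^sup>2 + 1) = [:2 * (real k - 1) * ((real k)\<^sup>2 - 2 * real k + 2):]"
      unfolding q lift by (simp_all add: power2_eq_square algebra_simps)
    then show ?thesis
      by (auto simp: const_poly_mat_def dim simp flip: entry intro!: eq_matI)
  qed
  have "det (shift_mat - coeff_mat * incidence_mat) = det ?D"
    unfolding lift1 lift2 shift_minus_coeff_mult_incidence q_def[symmetric]
    by (rule det_adjacency_blocks) simp
  \<comment> \<open>\<open>det_diff_mult\<close> leaves the factor det S = (\<lambda>^2 - 4)^n on
    the left. It divides det Z = (\<lambda>^2 - 4)^m as n \<le> m, and cancels as a nonzero
    polynomial.\<close>
  then have "?p * (X\<^sup>2 - 4) ^ n = (X\<^sup>2 - 4) ^ ?m * det ?D"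
    using det_diff_mult[OF carriers(5,2,3,4) arev_mult_incidence]
    unfolding char_poly_def char_poly_matrix_cube_support det_shift_mat det_arev_mat by simp
  also have "(X\<^sup>2 - 4) ^ ?m = (X\<^sup>2 - 4) ^ (?m - n) * (X\<^sup>2 - 4) ^ n"
    using n_le by (simp flip: power_add)
  finally have "?p * (X\<^sup>2 - 4) ^ n = ((X\<^sup>2 - 4) ^ (?m - n) * det ?D) * (X\<^sup>2 - 4) ^ n"
    by (simp only: ac_simps)
  moreover have "X\<^sup>2 - 4 \<noteq> 0"
    by (simp add: power2_eq_square numeral_poly)
  ultimately show ?thesis by (simp only: mult_cancel_right power_eq_0_iff simp_thms)
qed

end

theorem corollary5p3:
  fixes G :: "('v, 'e) pre_digraph" and arev :: "'e \<Rightarrow> 'e"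
    and vs :: "'v list" and es :: "'e list" and k n m :: nat
  assumes "fin_digraph G" and "bidirected_digraph G arev"
    and "Digraph_Component.connected G"
    and "regular G arev k" and "k > 2"
    and "girth G arev > 4"
    and "n = card (verts G)" and "m = card (edges G arev)"
    and "distinct vs" and "set vs = verts G"
    and "distinct es" and "set es = arcs G"
  shows
    "let A = adjacency_matrix G arev vs;
         U = grover_matrix G arev es;
         X = [:0, 1:] :: real poly
     in char_poly (positive_support (U ^\<^sub>m 3)) =
        (X\<^sup>2 - 4) ^ (m - n) *
        det (X\<^sup>2 \<cdot>\<^sub>m 1\<^sub>m n
             - X \<cdot>\<^sub>m const_poly_mat (A ^\<^sub>m 3 - (3 * real k - 4) \<cdot>\<^sub>m A)
             + const_poly_mat (A ^\<^sub>m 4 - (real k)\<^sup>2 \<cdot>\<^sub>m A ^\<^sub>m 2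
                 + (2 * (real k - 1) * ((real k)\<^sup>2 - 2 * real k + 2)) \<cdot>\<^sub>m 1\<^sub>m n))"
proof -
  interpret fin_digraph G by fact
  interpret bidirected_digraph G arev by fact
  interpret enumerated_graph G arev k vs es
    using assms by unfold_locales auto
  show ?thesis
    using char_poly_cube_support n_eq assms(7,8) by (simp add: Let_def)
qed

end
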